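(* Let $f\in\mathcal{K}$ have Taylor expansion $f(z)=z+\sum_{n=2}^{\infty}a_nz^n$ in $\mathbb{D}$. Then $|T_3(2)|\le 86$.
   Context: $\mathbb{D}=\{z\in\mathbb{C}:|z|<1\}$. $\mathcal{A}$ is the class of analytic functions $f$ in $\mathbb{D}$ with Taylor series $f(z)=z+\sum_{n=2}^\infty a_nz^n$. $\mathcal{S}^*$ is the class of univalent functions $g\in\mathcal{A}$ for which $g(\mathbb{D})$ is starlike with respect to the origin; equivalently, $g\in\mathcal{A}$ and $\operatorname{Re}(zg'(z)/g(z))>0$ in $\mathbb{D}$. $\mathcal{K}$ is the class of close-to-convex functions: $f\in\mathcal{A}$ belongs to $\mathcal{K}$ if there exist $g\in\mathcal{S}^*$ and a real number $\alpha\in(-\pi/2,\pi/2)$ such that $\operatorname{Re}\left(e^{i\alpha}\frac{zf'(z)}{g(z)}\right)>0$ for $z\in\mathbb{D}$. The symmetric Toeplitz determinant $T_3(2)$ of $f$ is $T_3(2)=\det\begin{pmatrix} a_2 & a_3 & a_4 \\ a_3 & a_2 & a_3 \\ a_4 & a_3 & a_2 \end{pmatrix}$. *)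

theory Defs
  imports "HOL-Complex_Analysis.Complex_Analysis"
begin

definition unit_disc :: "complex set" where
  "unit_disc = ball 0 1"

text \<open>The expansion $f(z) = z + \sum_{n \ge 2} a_n z^n$ in the disc; the values \<open>a 0\<close> and
  \<open>a 1\<close> are not used.\<close>

definition normalized_expansion :: "(complex \<Rightarrow> complex) \<Rightarrow> (nat \<Rightarrow> complex) \<Rightarrow> bool" where
  "normalized_expansion f a \<longleftrightarrow>
     (\<forall>z\<in>unit_disc. (\<lambda>n. a (n + 2) * z ^ (n + 2)) sums (f z - z))"

definition class_A :: "(complex \<Rightarrow> complex) set" where
  "class_A = {f. f holomorphic_on unit_disc \<and> (\<exists>a. normalized_expansion f a)}"

text \<open>The library's \<^const>\<open>starlike\<close> asserts the existence of some centre; here the centre is given.\<close>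

definition starlike_wrt :: "'a::real_vector \<Rightarrow> 'a set \<Rightarrow> bool" where
  "starlike_wrt p S \<longleftrightarrow> p \<in> S \<and> (\<forall>x\<in>S. closed_segment p x \<subseteq> S)"

definition class_S_star :: "(complex \<Rightarrow> complex) set" where
  "class_S_star =
     {g. g \<in> class_A \<and> inj_on g unit_disc \<and> starlike_wrt 0 (g ` unit_disc)}"

text \<open>At \<open>z = 0\<close> the quotient $z f'(z) / g(z)$ has a removable singularity with value
  $f'(0) / g'(0) = 1$, where the condition reads $\cos \alpha > 0$ and holds automatically.
  The origin is left out because \<open>0 / 0 = 0\<close> in HOL.\<close>

definition close_to_convex :: "(complex \<Rightarrow> complex) set" where
  "close_to_convex =
     {f. f \<in> class_A \<and>
         (\<exists>g\<in>class_S_star. \<exists>\<alpha>\<in>{- pi / 2 <..< pi / 2}.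
            \<forall>z\<in>unit_disc - {0}. Re (exp (\<i> * complex_of_real \<alpha>) * (z * deriv f z / g z)) > 0)}"

definition toeplitz_3_2 :: "(nat \<Rightarrow> complex) \<Rightarrow> complex" where
  "toeplitz_3_2 a =
     det (vector [vector [a 2, a 3, a 4],
                  vector [a 3, a 2, a 3],
                  vector [a 4, a 3, a 2]] :: complex ^ 3 ^ 3)"

end

theory Submission
  imports Defs
begin

text \<open>
  The determinant factors as \<open>(a\<^sub>2 - a\<^sub>4) (a\<^sub>2\<^sup>2 - (2 a\<^sub>3\<^sup>2 - a\<^sub>2 a\<^sub>4))\<close>. Since \<open>\<bar>a\<^sub>2\<bar> \<le> 2\<close> and
  \<open>\<bar>a\<^sub>4\<bar> \<le> 4\<close>, it suffices to show \<open>\<bar>2 a\<^sub>3\<^sup>2 - a\<^sub>2 a\<^sub>4\<bar> \<le> 31/3\<close>, because \<open>6 (4 + 31/3) = 86\<close>.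
  The coefficients of \<open>f\<close> are polynomials in those of \<open>p = z g' / g\<close> and \<open>q = z f' / g\<close>; here \<open>p\<close> has
  nonnegative real part, and \<open>q = 1 + \<kappa> (h - 1)\<close> with \<open>Re h \<ge> 0\<close> and \<open>\<kappa> = cos \<alpha> e\<^sup>-\<^sup>i\<^sup>\<alpha>\<close>, so that
  \<open>\<bar>1 - 2 \<kappa>\<bar> = 1\<close>. For a function \<open>h\<close> with nonnegative real part and \<open>h 0 = 1\<close>, positivity of the
  measure \<open>Re h\<close> on circles gives \<open>\<bar>h\<^sub>a\<^sub>+\<^sub>b - h\<^sub>a h\<^sub>b / 2\<bar> \<le> 2 - (\<bar>h\<^sub>a\<bar>\<^sup>2 + \<bar>h\<^sub>b\<bar>\<^sup>2) / 4\<close>. This bounds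
  \<open>h\<^sub>a\<^sub>+\<^sub>b - w h\<^sub>a h\<^sub>b\<close> by 2 whenever \<open>\<bar>1 - 2 w\<bar> \<le> 1\<close>, and also the Hankel determinant
  \<open>h\<^sub>2\<^sup>2 - h\<^sub>1 h\<^sub>3\<close>; the triangle inequality does the rest.
\<close>

section \<open>Fourier coefficients on circles\<close>

text \<open>Cauchy's formula for the \<open>n\<close>-th derivative at 0, with the circle
  parametrised by the angle.\<close>

lemma circle_fourier_coeff:
  assumes h: "h holomorphic_on ball 0 1" and H: "h has_fps_expansion H"
    and r: "0 < r" "r < 1"
  shows "((\<lambda>t. h (of_real r * cis t) * cis (- (real n * t))) has_integral
           2 * of_real pi * fps_nth H n * of_real r ^ n) {0..2 * pi}"
proof -
  have sub: "cball 0 r \<subseteq> (ball 0 1 :: complex set)"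
    using r by auto
  have c: "continuous_on (cball 0 r) h"
    using h sub holomorphic_on_imp_continuous_on continuous_on_subset by blast
  have "h holomorphic_on ball 0 r"
    using h sub ball_subset_cball by (meson holomorphic_on_subset subset_trans)
  from Cauchy_has_contour_integral_higher_derivative_circlepath[OF c this, of 0 n] r
  have "((\<lambda>u. h u / u ^ Suc n) has_contour_integral (2 * pi * \<i>) / fact n * (deriv ^^ n) h 0)
          (circlepath 0 r)"
    by simp
  then have "((\<lambda>t. h (of_real r * cis t) / (of_real r * cis t) ^ Suc n * of_real r * \<i> * cis t)
      has_integral (2 * pi * \<i>) * fps_nth H n) {0..2*pi}"
    unfolding circlepath_def
    by (subst (asm) has_contour_integral_part_circlepath_iff) 
       (auto simp: fps_nth_fps_expansion[OF H])
  \<comment> \<open>On the circle, du / u^(n+1) is i e^(-int) r^(-n) dt; the new factor leaves only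
    e^(-int) dt.\<close>
  then have "((\<lambda>t. (of_real r ^ n / \<i>) * (h (of_real r * cis t) / (of_real r * cis t) ^ Suc n * of_real r * \<i> * cis t))
      has_integral (of_real r ^ n / \<i>) * ((2 * pi * \<i>) * fps_nth H n)) {0..2*pi}"
    by (rule has_integral_mult_right)
  moreover have "(of_real r ^ n / \<i>) * (h (of_real r * cis t) / (of_real r * cis t) ^ Suc n * of_real r * \<i> * cis t)
     = h (of_real r * cis t) * cis (- (real n * t))" for t
    using r by (simp add: power_mult_distrib field_simps Complex.DeMoivre cis_neq_zero
        flip: cis_divide cis_inverse cis_cnj)
  moreover have "(z / \<i>) * ((of_real (2 * pi) * \<i>) * y) = 2 * of_real pi * y * z" for y z
    by (simp add: field_simps)
  ultimately show ?thesis
    by (simp only:)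
qed

text \<open>Coefficients of negative index vanish by Cauchy's theorem. The exponent in the proof is
  \<open>n - 1\<close> because du contributes one more factor \<open>u\<close>.\<close>

lemma circle_fourier_coeff_neg:
  assumes h: "h holomorphic_on ball 0 1" and r: "0 < r" "r < 1" and n: "n > 0"
  shows "((\<lambda>t. h (of_real r * cis t) * cis (real n * t)) has_integral 0) {0..2 * pi}"
proof -
  obtain m where m: "n = Suc m"
    using n gr0_implies_Suc by blast
  have "((\<lambda>u. h u * u ^ m) has_contour_integral 0) (circlepath 0 r)"
    by (rule Cauchy_theorem_disc_simple[of _ 0 1]) (use h r in \<open>auto intro!: holomorphic_intros\<close>)
  then have "((\<lambda>t. h (of_real r * cis t) * (of_real r * cis t) ^ m * of_real r * \<i> * cis t)
      has_integral 0) {0..2*pi}"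
    unfolding circlepath_def
    by (subst (asm) has_contour_integral_part_circlepath_iff) auto
  then have "((\<lambda>t. (1 / (\<i> * of_real r ^ n)) * (h (of_real r * cis t) * (of_real r * cis t) ^ m * of_real r * \<i> * cis t))
      has_integral (1 / (\<i> * of_real r ^ n)) * 0) {0..2*pi}"
    by (rule has_integral_mult_right)
  moreover have "(1 / (\<i> * of_real r ^ n)) * (h (of_real r * cis t) * (of_real r * cis t) ^ m * of_real r * \<i> * cis t)
     = h (of_real r * cis t) * cis (real n * t)" for t
  proof -
    have "cis (real n * t) = cis t ^ n"
      by (rule Complex.DeMoivre[symmetric])
    then show ?thesis
      using r by (simp add: m power_mult_distrib field_simps)
  qed
  ultimately show ?thesis
    by simp
qed

text \<open>\<open>Re h\<close> is the mean of \<open>h\<close> and its conjugate. For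
  \<open>n > 0\<close> the conjugate contributes only a negative-index coefficient, that is 0, which
  halves the constant 2 pi.\<close>

lemma circle_fourier_coeff_Re:
  assumes h: "h holomorphic_on ball 0 1" and H: "h has_fps_expansion H"
    and r: "0 < r" "r < 1" and n: "n > 0"
  shows "((\<lambda>t. of_real (Re (h (of_real r * cis t))) * cis (- (real n * t))) has_integral
           of_real pi * fps_nth H n * of_real r ^ n) {0..2 * pi}"
proof -
  have 1: "((\<lambda>t. cnj (h (of_real r * cis t) * cis (real n * t))) has_integral 0) {0..2 * pi}"
    using circle_fourier_coeff_neg[OF h r n] has_integral_cnj[of "\<lambda>t. h (of_real r * cis t) * cis (real n * t)" 0]
    by (simp add: o_def)
  have "((\<lambda>t. (h (of_real r * cis t) * cis (- (real n * t)) + cnj (h (of_real r * cis t) * cis (real n * t))) / 2)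
     has_integral (2 * of_real pi * fps_nth H n * of_real r ^ n + 0) / 2) {0..2*pi}"
    by (intro has_integral_divide has_integral_add circle_fourier_coeff assms 1)
  moreover have "(h z * cis (-s) + cnj (h z * cis s)) / 2 = of_real (Re (h z)) * cis (- s)" for z s
    by (auto simp: complex_eq_iff cis.ctr field_simps)
  ultimately show ?thesis
    by (simp add: mult.assoc)
qed

text \<open>The mean value property. At index 0 both \<open>h\<close> and its conjugate contribute,
  so the constant is 2 pi again.\<close>

lemma circle_mean_Re:
  assumes h: "h holomorphic_on ball 0 1" and r: "0 < r" "r < 1"
  shows "((\<lambda>t. complex_of_real (Re (h (of_real r * cis t)))) has_integral
           of_real (2 * pi * Re (h 0))) {0..2 * pi}"
proof -
  have H: "h has_fps_expansion fps_expansion h 0"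
    using h by (intro has_fps_expansion_fps_expansion[of "ball 0 1"]) auto
  have "fps_nth (fps_expansion h 0) 0 = h 0"
    by (simp add: fps_expansion_def)
  then have "((\<lambda>t. h (of_real r * cis t)) has_integral 2 * of_real pi * h 0) {0..2 * pi}"
    using circle_fourier_coeff[OF h H r, of 0] by simp
  from has_integral_Re[OF this]
  have "((\<lambda>t. Re (h (of_real r * cis t))) has_integral 2 * pi * Re (h 0)) {0..2*pi}"
    by simp
  then show ?thesis
    by (rule has_integral_of_real)
qed

section \<open>Coefficients of functions with nonnegative real part\<close>

text \<open>With respect to the probability measure with density \<open>Re h\<close> on a circle, \<open>h\<^sub>n / 2\<close> is the
  \<open>n\<close>-th moment, so the left-hand side is a covariance.\<close>

lemma caratheodory_covariance_bound:
  assumes h: "h holomorphic_on ball 0 1" and H: "h has_fps_expansion H"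
    and h0: "h 0 = 1" and pos: "\<And>z. z \<in> ball 0 1 \<Longrightarrow> Re (h z) \<ge> 0"
    and ab: "a > 0" "b > 0"
  shows "cmod (fps_nth H (a + b) - fps_nth H a * fps_nth H b / 2)
           \<le> 2 - ((cmod (fps_nth H a))\<^sup>2 + (cmod (fps_nth H b))\<^sup>2) / 4"
proof -
  \<comment> \<open>The \<open>n\<close>-th moment on the circle of radius \<open>r\<close>. The
    inequality is proved for \<open>r < 1\<close>, then \<open>r\<close> tends to 1.\<close>
  define c where "c n r = fps_nth H n * of_real r ^ n / 2" for n and r :: real
  have main: "cmod (c (a + b) r - c a r * c b r) \<le> 1 - ((cmod (c a r))\<^sup>2 + (cmod (c b r))\<^sup>2) / 2"
    if r: "0 < r" "r < 1" for r
  proof -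
    define A B D where "A = c a r" and "B = c b r" and "D = c (a + b) r - A * B"
    \<comment> \<open>A rotation that turns \<open>D\<close> into \<open>- cmod D\<close>. As
      \<open>sgn 0 = 0\<close>, the case \<open>D = 0\<close> needs its own value of modulus
      1.\<close>
    define x where "x = (if D = 0 then 1 else - cnj (sgn D))"
    have x: "cmod x = 1"
      by (simp add: x_def norm_sgn)
    have xD: "x * D = - of_real (cmod D)"
      by (auto simp: x_def sgn_div_norm scaleR_conv_of_real complex_norm_square[symmetric] 
          divide_simps power2_eq_square mult.commute[of "cnj D"] simp flip: of_real_mult)
    define w where "w t = complex_of_real (Re (h (of_real r * cis t)))" for t
    define E where "E n t = cis (- (real n * t))" for n t
    have E: "cmod (E n t) = 1" "E (a + b) t = E a t * E b t" for n t
      by (auto simp: E_def cis_mult algebra_simps)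
    define P K where "P = complex_of_real (2 * pi)"
      and "K = complex_of_real (2 + (cmod A)\<^sup>2 + (cmod B)\<^sup>2)"
    have m: "((\<lambda>t. w t * E n t) has_integral P * c n r) {0..2*pi}" if "n > 0" for n
      using circle_fourier_coeff_Re[OF h H r that] by (simp add: w_def E_def c_def P_def mult.assoc)
    have m0: "(w has_integral P) {0..2*pi}"
      using circle_mean_Re[OF h r] h0 by (simp add: w_def[abs_def] P_def)
    \<comment> \<open>Multiplied out so that it integrates term by term. Its real part is the
      density times a sum that is nonnegative by 2uv \<le> u^2 + v^2; see \<open>F\<close> and
      \<open>nn\<close>.\<close>
    let ?F = "\<lambda>t. K * w t - 2 * cnj A * (w t * E a t) - 2 * cnj B * (w t * E b t)
           + 2 * x * (w t * E (a + b) t - A * (w t * E b t) - B * (w t * E a t) + A * B * w t)"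
    let ?I = "K * P - 2 * cnj A * (P * c a r) - 2 * cnj B * (P * c b r)
           + 2 * x * (P * c (a + b) r - A * (P * c b r) - B * (P * c a r) + A * B * P)"
    have "(?F has_integral ?I) {0..2*pi}"
      by (intro has_integral_add has_integral_diff has_integral_mult_right m m0) (use ab in auto)
    then have int: "((\<lambda>t. Re (?F t)) has_integral Re ?I) {0..2*pi}"
      by (rule has_integral_Re)
    have F: "Re (?F t) = Re (w t) * ((cmod (E a t - A))\<^sup>2 + (cmod (E b t - B))\<^sup>2
                 + 2 * Re (x * (E a t - A) * (E b t - B)))" for t
    proof -
      have e: "(cmod (e - A))\<^sup>2 = 1 + (cmod A)\<^sup>2 - 2 * Re (cnj A * e)" if "cmod e = 1" for e A
      proof -
        have "(cmod (e - A))\<^sup>2 = (cmod e)\<^sup>2 + (cmod A)\<^sup>2 - 2 * Re (cnj A * e)"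
          unfolding cmod_power2 by (simp add: power2_eq_square algebra_simps)
        then show ?thesis using that by simp
      qed
      have "?F t = w t * (K - 2 * (cnj A * E a t) - 2 * (cnj B * E b t)
                 + 2 * (x * (E a t - A) * (E b t - B)))"
        unfolding E(2) by (simp add: algebra_simps)
      moreover have "Re (w t * y) = Re (w t) * Re y" for y
        by (simp add: w_def)
      moreover have "Re (2 * y) = 2 * Re y" for y
        by simp
      moreover have "Re K = 2 + (cmod A)\<^sup>2 + (cmod B)\<^sup>2"
        by (simp add: K_def)
      ultimately show ?thesis
        by (simp only: e[OF E(1)] plus_complex.sel minus_complex.sel) simp
    qed
    have nn: "Re (?F t) \<ge> 0" if "t \<in> {0..2*pi}" for t
    proof -
      have "Re (w t) \<ge> 0"
        using pos[of "of_real r * cis t"] r by (simp add: w_def norm_mult)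
      moreover have "\<bar>Re (x * (E a t - A) * (E b t - B))\<bar> \<le> cmod (E a t - A) * cmod (E b t - B)"
        using abs_Re_le_cmod[of "x * (E a t - A) * (E b t - B)"] by (simp add: norm_mult x)
      moreover have "2 * u * v \<le> u\<^sup>2 + v\<^sup>2" for u v :: real
        by (rule sum_squares_bound)
      from this[of "cmod (E a t - A)" "cmod (E b t - B)"] calculation(2)
      have "0 \<le> (cmod (E a t - A))\<^sup>2 + (cmod (E b t - B))\<^sup>2
                 + 2 * Re (x * (E a t - A) * (E b t - B))"
        by linarith
      ultimately show ?thesis
        unfolding F by (intro mult_nonneg_nonneg)
    qed
    have "0 \<le> Re ?I"
      using has_integral_nonneg[OF int nn] by simp
    also have "?I = of_real (4 * pi * (1 - ((cmod A)\<^sup>2 + (cmod B)\<^sup>2) / 2 - cmod D))"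
    proof -
      have "?I = P * (K - 2 * (A * cnj A) - 2 * (B * cnj B) + 2 * (x * D))"
        by (simp add: A_def[symmetric] B_def[symmetric] D_def algebra_simps)
      also have "\<dots> = P * of_real (2 + (cmod A)\<^sup>2 + (cmod B)\<^sup>2 - 2 * (cmod A)\<^sup>2 - 2 * (cmod B)\<^sup>2 - 2 * cmod D)"
        unfolding xD K_def complex_norm_square[symmetric] by simp
      also have "\<dots> = of_real (4 * pi * (1 - ((cmod A)\<^sup>2 + (cmod B)\<^sup>2) / 2 - cmod D))"
        unfolding P_def of_real_mult[symmetric] by (simp only: of_real_eq_iff) (simp add: field_simps)
      finally show ?thesis .
    qed
    finally have "0 \<le> 1 - ((cmod A)\<^sup>2 + (cmod B)\<^sup>2) / 2 - cmod D"
      using pi_gt_zero by (simp only: Re_complex_of_real zero_le_mult_iff) linarith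
    then show ?thesis
      unfolding A_def B_def D_def by linarith
  qed
  have lim: "((\<lambda>r. c n r) \<longlongrightarrow> fps_nth H n / 2) (at_left 1)" for n
  proof -
    have "((\<lambda>r. c n r) \<longlongrightarrow> fps_nth H n * of_real 1 ^ n / 2) (at_left 1)"
      unfolding c_def
      by (rule tendsto_divide[OF tendsto_mult[OF tendsto_const
            tendsto_power[OF tendsto_of_real[OF tendsto_ident_at]]] tendsto_const]) simp
    then show ?thesis
      by simp
  qed
  have "cmod (fps_nth H (a + b) / 2 - fps_nth H a / 2 * (fps_nth H b / 2))
         \<le> 1 - ((cmod (fps_nth H a / 2))\<^sup>2 + (cmod (fps_nth H b / 2))\<^sup>2) / 2"
  proof (rule tendsto_le[OF trivial_limit_at_left_real])
    show "((\<lambda>r. cmod (c (a + b) r - c a r * c b r)) \<longlongrightarrow>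
        cmod (fps_nth H (a + b) / 2 - fps_nth H a / 2 * (fps_nth H b / 2))) (at_left 1)"
      by (intro tendsto_intros lim)
    show "((\<lambda>r. 1 - ((cmod (c a r))\<^sup>2 + (cmod (c b r))\<^sup>2) / 2) \<longlongrightarrow>
        1 - ((cmod (fps_nth H a / 2))\<^sup>2 + (cmod (fps_nth H b / 2))\<^sup>2) / 2) (at_left 1)"
      by (intro tendsto_intros lim) auto
    show "\<forall>\<^sub>F r in at_left 1. cmod (c (a + b) r - c a r * c b r)
            \<le> 1 - ((cmod (c a r))\<^sup>2 + (cmod (c b r))\<^sup>2) / 2"
      using eventually_at_left_real[OF zero_less_one] by (rule eventually_mono) (simp add: main)
  qed
  moreover have "fps_nth H (a + b) / 2 - fps_nth H a / 2 * (fps_nth H b / 2)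
       = (fps_nth H (a + b) - fps_nth H a * fps_nth H b / 2) / 2"
    by (simp add: diff_divide_distrib)
  ultimately have "cmod (fps_nth H (a + b) - fps_nth H a * fps_nth H b / 2) / 2
         \<le> 1 - ((cmod (fps_nth H a))\<^sup>2 / 4 + (cmod (fps_nth H b))\<^sup>2 / 4) / 2"
    by (simp only: norm_divide power_divide norm_numeral) simp
  moreover have "x \<le> 2 - (y + z) / 4" if "x / 2 \<le> 1 - (y / 4 + z / 4) / 2" for x y z :: real
    using that by (simp add: field_simps)
  ultimately show ?thesis
    by blast
qed

text \<open>The case \<open>a = b = n\<close> of the covariance bound, whose right-hand side must be
  nonnegative.\<close>

lemma caratheodory_coeff_bound:
  assumes h: "h holomorphic_on ball 0 1" and H: "h has_fps_expansion H"
    and h0: "h 0 = 1" and pos: "\<And>z. z \<in> ball 0 1 \<Longrightarrow> Re (h z) \<ge> 0"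
    and n: "n > 0"
  shows "cmod (fps_nth H n) \<le> 2"
proof -
  have "0 \<le> 2 - ((cmod (fps_nth H n))\<^sup>2 + (cmod (fps_nth H n))\<^sup>2) / 4"
    using caratheodory_covariance_bound[OF h H h0 pos n n] by (meson norm_ge_zero order_trans)
  then have "(cmod (fps_nth H n))\<^sup>2 \<le> 2\<^sup>2"
    by simp
  then show ?thesis
    by (rule power2_le_imp_le) simp
qed

text \<open>Moving the weight from 1/2 to \<open>w\<close> costs at most half the modulus of the
  product, which the subtracted squares in the covariance bound pay for.\<close>

lemma caratheodory_coeff_diff_bound:
  assumes h: "h holomorphic_on ball 0 1" and H: "h has_fps_expansion H"
    and h0: "h 0 = 1" and pos: "\<And>z. z \<in> ball 0 1 \<Longrightarrow> Re (h z) \<ge> 0"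
    and ab: "a > 0" "b > 0" and w: "cmod (1 - 2 * w) \<le> 1"
  shows "cmod (fps_nth H (a + b) - w * fps_nth H a * fps_nth H b) \<le> 2"
proof -
  let ?x = "fps_nth H a" and ?y = "fps_nth H b"
  have "fps_nth H (a + b) - w * ?x * ?y = (fps_nth H (a + b) - ?x * ?y / 2) + (1 - 2 * w) * (?x * ?y / 2)"
    by (simp add: field_simps)
  then have "cmod (fps_nth H (a + b) - w * ?x * ?y)
      \<le> cmod (fps_nth H (a + b) - ?x * ?y / 2) + cmod (1 - 2 * w) * cmod (?x * ?y / 2)"
    by (metis norm_mult norm_triangle_ineq)
  also have "\<dots> \<le> 2 - ((cmod ?x)\<^sup>2 + (cmod ?y)\<^sup>2) / 4 + 1 * cmod (?x * ?y / 2)"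
    by (intro add_mono mult_right_mono caratheodory_covariance_bound[OF h H h0 pos ab] w) auto
  also have "\<dots> \<le> 2"
    using sum_squares_bound[of "cmod ?x" "cmod ?y"] by (simp add: norm_mult norm_divide)
  finally show ?thesis .
qed

text \<open>With x, y, z for the first three coefficients, y^2 - xz = y (y - x^2/2) - x (z - xy/2),
  and both brackets are covariances.\<close>

lemma caratheodory_hankel_bound:
  assumes h: "h holomorphic_on ball 0 1" and H: "h has_fps_expansion H"
    and h0: "h 0 = 1" and pos: "\<And>z. z \<in> ball 0 1 \<Longrightarrow> Re (h z) \<ge> 0"
  shows "cmod ((fps_nth H 2)\<^sup>2 - fps_nth H 1 * fps_nth H 3)
           \<le> 4 + 2 * cmod (fps_nth H 1) - (cmod (fps_nth H 1))\<^sup>2 - cmod (fps_nth H 1) ^ 3 / 4"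
proof -
  note cov = caratheodory_covariance_bound[OF h H h0 pos]
  let ?x = "fps_nth H 1" and ?y = "fps_nth H 2" and ?z = "fps_nth H 3"
  have "cmod (?y\<^sup>2 - ?x * ?z) = cmod (?y * (?y - ?x * ?x / 2) - ?x * (?z - ?x * ?y / 2))"
    by (simp add: algebra_simps power2_eq_square)
  also have "\<dots> \<le> cmod ?y * cmod (?y - ?x * ?x / 2) + cmod ?x * cmod (?z - ?x * ?y / 2)"
    by (metis norm_mult norm_triangle_ineq4)
  also have "\<dots> \<le> 2 * (2 - ((cmod ?x)\<^sup>2 + (cmod ?x)\<^sup>2) / 4)
      + cmod ?x * (2 - ((cmod ?x)\<^sup>2 + (cmod ?y)\<^sup>2) / 4)"
    using cov[of 1 1] cov[of 1 2] caratheodory_coeff_bound[OF h H h0 pos, of 2]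
    by (intro add_mono mult_mono) (auto simp: numeral_eq_Suc)
  also have "\<dots> \<le> 2 * (2 - ((cmod ?x)\<^sup>2 + (cmod ?x)\<^sup>2) / 4) + cmod ?x * (2 - (cmod ?x)\<^sup>2 / 4)"
    by (intro add_mono mult_left_mono) auto
  finally show ?thesis
    by (simp add: field_simps power2_eq_square power3_eq_cube)
qed

section \<open>Starlike functions\<close>

text \<open>By the Schwarz lemma \<open>g\<inverse> (\<rho> g z)\<close> has modulus at most \<open>\<bar>z\<bar>\<close> for \<open>0 \<le> \<rho> \<le> 1\<close>, so its
  squared modulus has a nonnegative derivative at \<open>\<rho> = 1\<close>.\<close>

lemma starlike_Re_nonneg:
  assumes g: "g holomorphic_on ball 0 1" and inj: "inj_on g (ball 0 1)" and g0: "g 0 = 0"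
    and star: "starlike_wrt 0 (g ` ball 0 1)" and z: "z \<in> ball 0 1"
  shows "Re (z * deriv g z / g z) \<ge> 0"
proof (cases "z = 0")
  case False
  obtain k where k: "k holomorphic_on g ` ball 0 1"
    and dk: "\<And>z. z \<in> ball 0 1 \<Longrightarrow> deriv g z * deriv k (g z) = 1"
    and kg: "\<And>z. z \<in> ball 0 1 \<Longrightarrow> k (g z) = z"
    using holomorphic_has_inverse[OF g open_ball inj] by metis
  have op: "open (g ` ball 0 1)"
    by (rule open_mapping_thm3[OF g open_ball inj])
  have scaled: "of_real \<rho> * g w \<in> g ` ball 0 1" if "w \<in> ball 0 1" "0 \<le> \<rho>" "\<rho> \<le> 1" for \<rho> w
  proof -
    have "of_real \<rho> * g w \<in> closed_segment 0 (g w)"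
      using that by (auto simp: in_segment scaleR_conv_of_real)
    then show ?thesis
      using star that by (auto simp: starlike_wrt_def)
  qed
  have schwarz: "cmod (k (of_real \<rho> * g z)) \<le> cmod z" if \<rho>: "0 \<le> \<rho>" "\<rho> \<le> 1" for \<rho>
  proof (rule Schwarz_Lemma(1)[where f = "\<lambda>w. k (of_real \<rho> * g w)"])
    have "(\<lambda>w. of_real \<rho> * g w) holomorphic_on ball 0 1"
      by (intro holomorphic_intros g)
    moreover have "(\<lambda>w. of_real \<rho> * g w) ` ball 0 1 \<subseteq> g ` ball 0 1"
      using scaled \<rho> by blast
    ultimately show "(\<lambda>w. k (of_real \<rho> * g w)) holomorphic_on ball 0 1"
      using holomorphic_on_compose_gen[OF _ k] by (simp add: o_def)
    show "k (of_real \<rho> * g 0) = 0"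
      using kg[of 0] g0 by simp
    show "cmod (k (of_real \<rho> * g w)) < 1" if "cmod w < 1" for w
      using scaled[of w \<rho>] \<rho> that kg by force
  qed (use z in auto)
  define F where "F \<rho> = k (of_real \<rho> * g z)" for \<rho>
  \<comment> \<open>The derivative of \<open>F\<close> at 1, equal to g(z) / g'(z) because
    \<open>k\<close> inverts \<open>g\<close>.\<close>
  define d where "d = deriv k (g z) * g z"
  have F1: "F 1 = z"
    using kg z by (simp add: F_def)
  have "(k has_field_derivative deriv k (g z)) (at (of_real 1 * g z))"
    using holomorphic_derivI[OF k op] z by auto
  then have "((\<lambda>w. k (w * g z)) has_field_derivative d) (at (of_real 1))"
    unfolding d_def by (rule DERIV_chain2) (auto intro!: derivative_eq_intros)
  then have F': "(F has_vector_derivative d) (at 1)"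
    unfolding F_def by (rule has_vector_derivative_real_field)
  define N where "N \<rho> = (Re (F \<rho>))\<^sup>2 + (Im (F \<rho>))\<^sup>2" for \<rho>
  have N': "(N has_real_derivative 2 * (Re z * Re d + Im z * Im d)) (at 1)"
    unfolding N_def using F'
    by (auto intro!: derivative_eq_intros simp: F1)
  \<comment> \<open>A negative derivative would make \<open>N\<close> exceed \<open>N 1\<close> just
    to the left of 1, against \<open>schwarz\<close>. Capping \<open>h\<close> at 1 keeps
    \<open>1 - h\<close> in [0, 1].\<close>
  have "\<not> 2 * (Re z * Re d + Im z * Im d) < 0"
  proof
    assume "2 * (Re z * Re d + Im z * Im d) < 0"
    from DERIV_neg_dec_left[OF N' this] obtain e where
      e: "e > 0" "\<And>h. h > 0 \<Longrightarrow> h < e \<Longrightarrow> N 1 < N (1 - h)"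
      by blast
    define h where "h = min (e / 2) 1"
    have h: "h > 0" "h < e" "h \<le> 1"
      using e(1) by (auto simp: h_def)
    have "cmod (F (1 - h)) \<le> cmod (F 1)"
      using schwarz[of "1 - h"] h F1 by (simp add: F_def)
    then have "N (1 - h) \<le> N 1"
      unfolding N_def cmod_power2[symmetric] by (intro power_mono) auto
    then show False
      using e(2)[OF h(1,2)] by simp
  qed
  then have "Re (z * cnj d) \<ge> 0"
    by simp
  then have "Re (z / d) \<ge> 0"
    by (simp add: Re_divide)
  moreover have "z * deriv g z / g z = z / d"
    using dk[OF z] by (simp add: d_def divide_inverse inverse_unique mult_ac)
  ultimately show ?thesis
    by simp
qed simp

section \<open>Power series and coefficient relations\<close>

text \<open>Entries 0 and 1 are set to the values that the normalisation forces; shifting the sum by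
  two restores the term \<open>z\<close>.\<close>

lemma normalized_expansion_has_fps:
  assumes "normalized_expansion f a"
  shows "f has_fps_expansion Abs_fps (\<lambda>n. if n = 0 then 0 else if n = 1 then 1 else a n)"
proof (rule has_fps_expansionI)
  let ?c = "\<lambda>n. if n = 0 then 0 else if n = 1 then 1 else a n"
  have "(\<lambda>n. ?c n * u ^ n) sums f u" if u: "u \<in> ball 0 1" for u
  proof -
    have "(\<lambda>n. ?c (n + 2) * u ^ (n + 2)) sums (f u - u)"
      using assms u by (simp add: normalized_expansion_def unit_disc_def)
    then have "(\<lambda>n. ?c n * u ^ n) sums (f u - u + (\<Sum>i<2. ?c i * u ^ i))"
      by (subst (asm) sums_iff_shift)
    then show ?thesis
      by (simp add: numeral_2_eq_2)
  qed
  then show "\<forall>\<^sub>F u in nhds 0. (\<lambda>n. fps_nth (Abs_fps ?c) n * u ^ n) sums f u"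
    using eventually_nhds_in_open[of "ball 0 1" "0 :: complex"] by (auto elim: eventually_mono)
qed

lemma normalized_expansion_at_0:
  assumes "normalized_expansion f a"
  shows "f 0 = 0" "deriv f 0 = 1"
  using fps_nth_fps_expansion[OF normalized_expansion_has_fps[OF assms], of 0]
    fps_nth_fps_expansion[OF normalized_expansion_has_fps[OF assms], of 1]
  by simp_all

text \<open>By injectivity \<open>g\<close> vanishes only at 0, and simply there, so
  \<open>q = f' / (g / z)\<close> is holomorphic on the whole disc. The relations compare
  coefficients in \<open>q g = z f'\<close>.\<close>

lemma quotient_coefficients:
  assumes f: "normalized_expansion f a" "f holomorphic_on ball 0 1"
    and g: "normalized_expansion g b" "g holomorphic_on ball 0 1" "inj_on g (ball 0 1)"
  obtains q Q where "q holomorphic_on ball 0 1" "q has_fps_expansion Q" "q 0 = 1"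
    "\<And>z. z \<in> ball 0 1 - {0} \<Longrightarrow> q z = z * deriv f z / g z"
    "2 * a 2 = b 2 + fps_nth Q 1"
    "3 * a 3 = b 3 + b 2 * fps_nth Q 1 + fps_nth Q 2"
    "4 * a 4 = b 4 + b 3 * fps_nth Q 1 + b 2 * fps_nth Q 2 + fps_nth Q 3"
proof -
  note f0 = normalized_expansion_at_0[OF f(1)] and g0 = normalized_expansion_at_0[OF g(1)]
  define G where "G z = (if z = 0 then 1 else g z / z)" for z
  have G: "G holomorphic_on ball 0 1"
    by (rule pole_theorem_open_0[OF g(2), of 0]) (auto simp: G_def g0)
  have gG: "g z = z * G z" for z
    by (simp add: G_def g0)
  have gnz: "g z \<noteq> 0" if "z \<in> ball 0 1" "z \<noteq> 0" for z
    using inj_onD[OF g(3), of z 0] that g0 by auto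
  have Gnz: "G z \<noteq> 0" if "z \<in> ball 0 1" for z
    using gnz[OF that] by (auto simp: G_def)
  define q where "q z = deriv f z / G z" for z
  have q: "q holomorphic_on ball 0 1"
    unfolding q_def by (intro holomorphic_intros holomorphic_deriv f G Gnz) auto
  define Q where "Q = fps_expansion q 0"
  have Q: "q has_fps_expansion Q"
    unfolding Q_def by (rule has_fps_expansion_fps_expansion[OF open_ball _ q]) simp
  have q0: "q 0 = 1"
    by (simp add: q_def G_def f0)
  let ?fps = "\<lambda>a. Abs_fps (\<lambda>n. if n = 0 then 0 else if n = 1 then 1 else a n) :: complex fps"
  have 1: "(\<lambda>z. q z * g z) has_fps_expansion Q * ?fps b"
    by (intro fps_expansion_intros Q normalized_expansion_has_fps g)
  have 2: "(\<lambda>z. z * deriv f z) has_fps_expansion fps_X * fps_deriv (?fps a)"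
    by (intro fps_expansion_intros normalized_expansion_has_fps f)
  have "\<forall>\<^sub>F z in nhds 0. q z * g z = z * deriv f z"
    using eventually_nhds_in_open[of "ball 0 1" "0 :: complex"]
    by (rule eventually_mono) (use Gnz in \<open>auto simp: q_def gG\<close>)
  from has_fps_expansion_cong[THEN iffD1, OF this refl 1]
  have eq: "Q * ?fps b = fps_X * fps_deriv (?fps a)"
    using 2 by (rule fps_expansion_unique_complex)
  have Q0: "fps_nth Q 0 = 1"
    using fps_nth_fps_expansion[OF Q, of 0] q0 by simp
  have eqn: "fps_nth (Q * ?fps b) n = fps_nth (fps_X * fps_deriv (?fps a)) n" for n
    by (simp only: eq)
  show ?thesis
  proof (rule that[OF q Q q0])
    show "q z = z * deriv f z / g z" if "z \<in> ball 0 1 - {0}" for z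
      using that by (simp add: q_def G_def)
    show "2 * a 2 = b 2 + fps_nth Q 1"
      using eqn[of 2] by (simp add: fps_mult_nth Q0 numeral_eq_Suc)
    show "3 * a 3 = b 3 + b 2 * fps_nth Q 1 + fps_nth Q 2"
      using eqn[of 3] by (simp add: fps_mult_nth Q0 numeral_eq_Suc algebra_simps)
    show "4 * a 4 = b 4 + b 3 * fps_nth Q 1 + b 2 * fps_nth Q 2 + fps_nth Q 3"
      using eqn[of 4] by (simp add: fps_mult_nth Q0 numeral_eq_Suc algebra_simps)
  qed
qed

section \<open>Estimates in terms of the coefficients of \<open>p\<close> and
  \<open>q\<close>\<close>

lemma norm_mult_mono:
  fixes x y :: "'a::real_normed_algebra"
  assumes "norm x \<le> r" "norm y \<le> s"
  shows "norm (x * y) \<le> r * s"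
  using assms by (meson mult_mono norm_ge_zero norm_mult_ineq order_trans)

text \<open>The denominators are 18 in \<open>2 * a3\<^sup>2\<close> and 48 in
  \<open>a2 * a4\<close>, so 144 clears both.\<close>

lemma norm_weighted_hankel_le:
  fixes p1 p2 p3 q1 q2 q3 a2 a3 a4 b2 b3 b4 :: complex
  assumes b: "b2 = p1" "2 * b3 = b2 * p1 + p2" "3 * b4 = b3 * p1 + b2 * p2 + p3"
    and a: "2 * a2 = b2 + q1" "3 * a3 = b3 + b2 * q1 + q2" "4 * a4 = b4 + b3 * q1 + b2 * q2 + q3"
    and p: "cmod p1 \<le> 2" "cmod p2 \<le> 2" "cmod (p1 * p1 - p2) \<le> 2" "cmod (p1 * p2 - p3) \<le> 2"
    and q: "cmod q1 \<le> 2" "cmod q2 \<le> 2" "cmod (q1 * q2 - q3) \<le> 2"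
    and hankel: "cmod (q2 * q2 - q1 * q3) \<le> 4 + 2 * cmod q1 - (cmod q1)\<^sup>2 - cmod q1 ^ 3 / 4"
  shows "cmod (2 * a3\<^sup>2 - a2 * a4) \<le> 31 / 3"
proof -
  have b3: "b3 = (p1 * p1 + p2) / 2"
    using b by (simp add: field_simps)
  have b4: "b4 = (b3 * p1 + p1 * p2 + p3) / 3"
    using b by (simp add: field_simps)
  have a': "a2 = (p1 + q1) / 2" "a3 = (b3 + p1 * q1 + q2) / 3" "a4 = (b4 + b3 * q1 + p1 * q2 + q3) / 4"
    using a b by (simp_all add: field_simps)
  text \<open>Every negative monomial is absorbed into a difference whose modulus is bounded better than
    termwise; estimating all monomials separately would give too much.\<close>
  have eq: "144 * (2 * a3\<^sup>2 - a2 * a4) =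
      8 * (p2 * p2) + 5 * (p1 * p1 * (p1 * p1)) + 14 * (p1 * p1 * (q1 * q1))
      + 9 * (q1 * q1 * (p1 * p1 - p2)) + 14 * (q2 * q2) + 18 * (q2 * q2 - q1 * q3)
      + p1 * p1 * p2 + 8 * (p1 * p2 * q1) + 32 * (p2 * q2) + 20 * (p1 * p1 * p1 * q1)
      + 14 * (p1 * p1 * q2) + 28 * (p1 * q1 * q2) + 18 * (p1 * (q1 * q2 - q3))
      + 6 * (p1 * (p1 * p2 - p3)) + 6 * (q1 * (p1 * p2 - p3))"
    unfolding a' b4 b3 by (simp add: field_simps power2_eq_square)
  \<comment> \<open>The bound in \<open>hankel\<close> peaks inside [0, 2] while the other terms
    peak at 2, so \<open>cmod q1\<close> stays a variable until everything is added up.\<close>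
  define t where "t = cmod q1"
  have t: "0 \<le> t" "t \<le> 2" and tq: "cmod q1 \<le> t"
    using q by (auto simp: t_def)
  have num: "cmod (numeral n) \<le> numeral n" for n
    by simp
  have "cmod (144 * (2 * a3\<^sup>2 - a2 * a4)) \<le>
      8 * (2 * 2) + 5 * (2 * 2 * (2 * 2)) + 14 * (2 * 2 * (t * t))
      + 9 * (t * t * 2) + 14 * (2 * 2) + 18 * (4 + 2 * t - t\<^sup>2 - t ^ 3 / 4)
      + 2 * 2 * 2 + 8 * (2 * 2 * t) + 32 * (2 * 2) + 20 * (2 * 2 * 2 * t)
      + 14 * (2 * 2 * 2) + 28 * (2 * t * 2) + 18 * (2 * 2)
      + 6 * (2 * 2) + 6 * (t * 2)"
    unfolding eq
    by (intro norm_triangle_mono norm_mult_mono num p q(2,3) tq hankel[folded t_def])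
  also have "\<dots> = 584 + 352 * t + 56 * t\<^sup>2 - 9 / 2 * t ^ 3"
    by (simp add: power2_eq_square algebra_simps)
  \<comment> \<open>1488 is 144 * 31/3. The tangent at 2 bounds t^3 from below and the chord over
    [0, 2] bounds t^2 from above, which leaves a linear inequality.\<close>
  also have "\<dots> \<le> 1488"
  proof -
    have "(t - 2)\<^sup>2 * (t + 4) \<ge> 0" "t * (2 - t) \<ge> 0"
      using t by auto
    then have "t ^ 3 \<ge> 12 * t - 16" "t\<^sup>2 \<le> 2 * t"
      by (simp_all add: power2_eq_square power3_eq_cube algebra_simps)
    then show ?thesis
      using t by linarith
  qed
  finally show ?thesis
    by (simp only: norm_mult norm_numeral)
qed

text \<open>All signs are positive, so the triangle inequality suffices; it yields the Koebe values
  2, 3, 4 for the starlike function on the way.\<close>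

lemma norm_fourth_coeff_le:
  fixes p1 p2 p3 q1 q2 q3 a4 b2 b3 b4 :: complex
  assumes b: "b2 = p1" "2 * b3 = b2 * p1 + p2" "3 * b4 = b3 * p1 + b2 * p2 + p3"
    and a: "4 * a4 = b4 + b3 * q1 + b2 * q2 + q3"
    and p: "cmod p1 \<le> 2" "cmod p2 \<le> 2" "cmod p3 \<le> 2"
    and q: "cmod q1 \<le> 2" "cmod q2 \<le> 2" "cmod q3 \<le> 2"
  shows "cmod a4 \<le> 4"
proof -
  have b2: "cmod b2 \<le> 2"
    using b p by simp
  have "cmod (2 * b3) \<le> 2 * 2 + 2"
    unfolding b(2) by (intro norm_triangle_mono norm_mult_mono b2 p)
  then have b3: "cmod b3 \<le> 3"
    by (simp add: norm_mult)
  have "cmod (3 * b4) \<le> 3 * 2 + 2 * 2 + 2"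
    unfolding b(3) by (intro norm_triangle_mono norm_mult_mono b2 b3 p)
  then have b4: "cmod b4 \<le> 4"
    by (simp add: norm_mult)
  have "cmod (4 * a4) \<le> 4 + 3 * 2 + 2 * 2 + 2"
    unfolding a by (intro norm_triangle_mono norm_mult_mono b2 b3 b4 q)
  then show ?thesis
    by (simp add: norm_mult)
qed

text \<open>The vector (1, 0, -1) is an eigenvector with eigenvalue
  \<open>a 2 - a 4\<close>.\<close>

lemma toeplitz_3_2_eq:
  "toeplitz_3_2 a = (a 2 - a 4) * ((a 2)\<^sup>2 - (2 * (a 3)\<^sup>2 - a 2 * a 4))"
  unfolding toeplitz_3_2_def det_3 by (simp add: vector_3 algebra_simps power2_eq_square)

section \<open>The bound for close-to-convex functions\<close>

theorem theorem2p3: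
  fixes f :: "complex \<Rightarrow> complex" and a :: "nat \<Rightarrow> complex"
  assumes "f \<in> close_to_convex"
    and "normalized_expansion f a"
  shows "norm (toeplitz_3_2 a) \<le> 86"
proof -
  obtain g \<alpha> where fA: "f \<in> class_A" and gS: "g \<in> class_S_star"
    and \<alpha>: "- pi / 2 < \<alpha>" "\<alpha> < pi / 2"
    and pos: "\<And>z. z \<in> unit_disc - {0} \<Longrightarrow> Re (exp (\<i> * of_real \<alpha>) * (z * deriv f z / g z)) > 0"
    using assms(1) by (auto simp: close_to_convex_def)
  have f: "f holomorphic_on ball 0 1"
    using fA by (simp add: class_A_def unit_disc_def)
  obtain b where b: "normalized_expansion g b"
    using gS by (auto simp: class_S_star_def class_A_def)
  have g: "g holomorphic_on ball 0 1" "inj_on g (ball 0 1)" "starlike_wrt 0 (g ` ball 0 1)"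
    using gS by (auto simp: class_S_star_def class_A_def unit_disc_def)
  have g0: "g 0 = 0"
    by (rule normalized_expansion_at_0[OF b])

  \<comment> \<open>Here \<open>g\<close> takes both roles in
    \<open>quotient_coefficients\<close>.\<close>
  obtain p P where p: "p holomorphic_on ball 0 1" "p has_fps_expansion P" "p 0 = 1"
    and pz: "\<And>z. z \<in> ball 0 1 - {0} \<Longrightarrow> p z = z * deriv g z / g z"
    and bP: "2 * b 2 = b 2 + fps_nth P 1"
      "3 * b 3 = b 3 + b 2 * fps_nth P 1 + fps_nth P 2"
      "4 * b 4 = b 4 + b 3 * fps_nth P 1 + b 2 * fps_nth P 2 + fps_nth P 3"
    using quotient_coefficients[OF b g(1) b g(1,2)] by metis
  \<comment> \<open>At the origin the HOL quotient is 0 while \<open>p 0 = 1\<close>, hence the case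
    split.\<close>
  have Re_p: "Re (p z) \<ge> 0" if "z \<in> ball 0 1" for z
    using starlike_Re_nonneg[OF g(1,2) g0 g(3) that] pz[of z] that p(3) by (cases "z = 0") auto
  note P_le = caratheodory_coeff_bound[OF p Re_p]
    and P_diff = caratheodory_coeff_diff_bound[OF p Re_p]

  obtain q Q where q: "q holomorphic_on ball 0 1" "q has_fps_expansion Q" "q 0 = 1"
    and qz: "\<And>z. z \<in> ball 0 1 - {0} \<Longrightarrow> q z = z * deriv f z / g z"
    and aQ: "2 * a 2 = b 2 + fps_nth Q 1"
      "3 * a 3 = b 3 + b 2 * fps_nth Q 1 + fps_nth Q 2"
      "4 * a 4 = b 4 + b 3 * fps_nth Q 1 + b 2 * fps_nth Q 2 + fps_nth Q 3"
    using quotient_coefficients[OF assms(2) f b g(1,2)] by metis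

  define \<kappa> where "\<kappa> = of_real (cos \<alpha>) * cis (- \<alpha>)"
  have cos: "cos \<alpha> > 0"
    using \<alpha> by (intro cos_gt_zero_pi) auto
  then have \<kappa>0: "\<kappa> \<noteq> 0"
    by (simp add: \<kappa>_def)
  have \<kappa>_le: "cmod \<kappa> \<le> 1"
    using cos by (simp add: \<kappa>_def norm_mult)
  have \<kappa>1: "cmod (1 - 2 * \<kappa>) \<le> 1"
  proof -
    have "1 - 2 * \<kappa> = - cis (- (2 * \<alpha>))"
      by (simp add: complex_eq_iff \<kappa>_def cos_double_cos sin_double power2_eq_square)
    then show ?thesis
      by simp
  qed
  text \<open>The normalisation \<open>e\<^sup>i\<^sup>\<alpha> q = cos \<alpha> h + \<i> sin \<alpha>\<close>.\<close>
  define h where "h z = 1 + (q z - 1) / \<kappa>" for z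
  have h: "h holomorphic_on ball 0 1"
    unfolding h_def by (intro holomorphic_intros q \<kappa>0)
  define H where "H = 1 + fps_const (inverse \<kappa>) * (Q - 1)"
  have H: "h has_fps_expansion H"
    unfolding h_def H_def divide_inverse mult.commute[of _ "inverse \<kappa>"]
    by (intro fps_expansion_intros q)
  have h0: "h 0 = 1"
    by (simp add: h_def q)
  have Re_h: "Re (h z) \<ge> 0" if z: "z \<in> ball 0 1" for z
  proof (cases "z = 0")
    case False
    have "of_real (cos \<alpha>) * h z = cis \<alpha> * q z - \<i> * of_real (sin \<alpha>)"
    proof -
      have "of_real (cos \<alpha>) / \<kappa> = cis \<alpha>"
        using cos by (simp add: \<kappa>_def cis_inverse[symmetric] field_simps flip: cis_cnj)
      moreover have "of_real (cos \<alpha>) * h z = of_real (cos \<alpha>) + (of_real (cos \<alpha>) / \<kappa>) * (q z - 1)"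
        by (simp add: h_def distrib_left)
      ultimately have "of_real (cos \<alpha>) * h z = of_real (cos \<alpha>) + cis \<alpha> * (q z - 1)"
        by simp
      then show ?thesis
        by (simp add: algebra_simps cis_conv_exp[symmetric] complex_eq_iff)
    qed
    from arg_cong[OF this, of Re] have "cos \<alpha> * Re (h z) = Re (cis \<alpha> * q z)"
      by simp
    also have "\<dots> > 0"
      using pos[of z] qz[of z] z False by (simp add: unit_disc_def cis_conv_exp)
    finally show ?thesis
      using cos by (simp add: zero_less_mult_iff)
  qed (simp add: h0)
  have QH: "fps_nth Q n = \<kappa> * fps_nth H n" if "n > 0" for n
    using that \<kappa>0 by (simp add: H_def)

  have Q_le: "cmod (fps_nth Q n) \<le> 2" if "n > 0" for n
    using norm_mult_mono[OF \<kappa>_le caratheodory_coeff_bound[OF h H h0 Re_h that]] QH[OF that] by simp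
  have Q_diff: "cmod (fps_nth Q 1 * fps_nth Q 2 - fps_nth Q 3) \<le> 2"
  proof -
    \<comment> \<open>Passing from \<open>Q\<close> to \<open>H\<close> takes one factor \<kappa>
      out of the difference and leaves one on the product, so \<kappa> is the weight.\<close>
    have "cmod (fps_nth H (1 + 2) - \<kappa> * fps_nth H 1 * fps_nth H 2) \<le> 2"
      by (rule caratheodory_coeff_diff_bound[OF h H h0 Re_h _ _ \<kappa>1]) auto
    from norm_mult_mono[OF \<kappa>_le this]
    have "cmod (fps_nth Q 3 - fps_nth Q 1 * fps_nth Q 2) \<le> 2"
      by (simp add: QH algebra_simps numeral_eq_Suc)
    then show ?thesis
      by (simp add: norm_minus_commute)
  qed
  \<comment> \<open>The bound for \<open>H\<close> keeps its form for \<open>Q\<close>: the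
    determinant scales by \<kappa>^2, and as \<open>k \<le> 1\<close>, replacing k^2 by 1, k and k^3
    in the constant, linear and cubic terms only enlarges the right-hand side.\<close>
  have hankel: "cmod (fps_nth Q 2 * fps_nth Q 2 - fps_nth Q 1 * fps_nth Q 3)
      \<le> 4 + 2 * cmod (fps_nth Q 1) - (cmod (fps_nth Q 1))\<^sup>2 - cmod (fps_nth Q 1) ^ 3 / 4"
  proof -
    define k t where "k = cmod \<kappa>" and "t = cmod (fps_nth H 1)"
    have k: "0 \<le> k" "k \<le> 1" and t: "0 \<le> t"
      using \<kappa>_le by (auto simp: k_def t_def)
    have k2: "k\<^sup>2 \<le> k" "k\<^sup>2 \<le> 1" "k ^ 3 \<le> k\<^sup>2"
      using k by (auto simp: power2_eq_square power3_eq_cube mult_left_le mult_le_one)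
    have "fps_nth Q 2 * fps_nth Q 2 - fps_nth Q 1 * fps_nth Q 3 =
        \<kappa>\<^sup>2 * ((fps_nth H 2)\<^sup>2 - fps_nth H 1 * fps_nth H 3)"
      by (simp add: QH power2_eq_square algebra_simps)
    then have "cmod (fps_nth Q 2 * fps_nth Q 2 - fps_nth Q 1 * fps_nth Q 3)
        \<le> k\<^sup>2 * (4 + 2 * t - t\<^sup>2 - t ^ 3 / 4)"
      using mult_left_mono[OF caratheodory_hankel_bound[OF h H h0 Re_h], of "k\<^sup>2"]
      by (simp add: norm_mult norm_power k_def t_def)
    also have "\<dots> = 4 * k\<^sup>2 + 2 * (k\<^sup>2 * t) - (k * t)\<^sup>2 - k\<^sup>2 * t ^ 3 / 4"
      by (simp add: algebra_simps power_mult_distrib)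
    also have "\<dots> \<le> 4 + 2 * (k * t) - (k * t)\<^sup>2 - (k * t) ^ 3 / 4"
    proof -
      have "k\<^sup>2 * t \<le> k * t" "k ^ 3 * t ^ 3 \<le> k\<^sup>2 * t ^ 3"
        using k2 t by (auto intro: mult_right_mono)
      then show ?thesis
        using k2 unfolding power_mult_distrib[of k t 3] by linarith
    qed
    also have "k * t = cmod (fps_nth Q 1)"
      by (simp add: QH norm_mult k_def t_def)
    finally show ?thesis .
  qed

  have bP': "b 2 = fps_nth P 1" "2 * b 3 = b 2 * fps_nth P 1 + fps_nth P 2"
    "3 * b 4 = b 3 * fps_nth P 1 + b 2 * fps_nth P 2 + fps_nth P 3"
    using bP by (auto simp: algebra_simps)
  \<comment> \<open>Weight 1 is an endpoint of the admissible range.\<close>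
  have "cmod (fps_nth P 1 * fps_nth P 1 - fps_nth P 2) \<le> 2"
    "cmod (fps_nth P 1 * fps_nth P 2 - fps_nth P 3) \<le> 2"
    using P_diff[of 1 1 1] P_diff[of 1 2 1] by (auto simp: norm_minus_commute numeral_eq_Suc)
  then have E: "cmod (2 * (a 3)\<^sup>2 - a 2 * a 4) \<le> 31 / 3"
    by (intro norm_weighted_hankel_le[OF bP' aQ] P_le Q_le Q_diff hankel) auto
  have a4: "cmod (a 4) \<le> 4"
    by (intro norm_fourth_coeff_le[OF bP' aQ(3)] P_le Q_le) auto
  have "cmod (2 * a 2) \<le> 2 + 2"
    unfolding aQ(1) bP'(1) by (intro norm_triangle_mono P_le Q_le) auto
  then have a2: "cmod (a 2) \<le> 2"
    by (simp add: norm_mult)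
  have "cmod (a 2 - a 4) \<le> 2 + 4"
    using norm_triangle_ineq4[of "a 2" "a 4"] a2 a4 by linarith
  moreover have "cmod ((a 2)\<^sup>2 - (2 * (a 3)\<^sup>2 - a 2 * a 4)) \<le> 2 * 2 + 31 / 3"
    using norm_triangle_ineq4[of "(a 2)\<^sup>2" "2 * (a 3)\<^sup>2 - a 2 * a 4"] E norm_mult_mono[OF a2 a2]
    unfolding power2_eq_square by linarith
  ultimately have "cmod (toeplitz_3_2 a) \<le> (2 + 4) * (2 * 2 + 31 / 3)"
    unfolding toeplitz_3_2_eq by (rule norm_mult_mono)
  then show ?thesis
    by simp
qed

end
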